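(* Let $Y$ be a walk regular graph and let $X=Y^f$ be a cyclic 2ev-cover of $Y$. Then $X$ is walk regular.
   Context: All graphs are finite, simple and undirected; the base graph $Y=(V,E)$ is connected. Covers: let $G$ be a permutation group on $R=\{1,\dots,r\}$. A symmetric arc function is a function $f:V\times V\to G\cup\{0\}$ such that $f(u,v)=0$ if and only if $\{u,v\}\notin E$, and $f(u,v)=f(v,u)^{-1}$ whenever $f(u,v)\in G$. The cover $Y^f$ (of index $r$, or $r$-fold) is the graph with vertex set $V\times R$ in which $(v,j)$ is adjacent to $(u,k)$ exactly when $v$ is adjacent to $u$ in $Y$ and $f(u,v)j=k$. The function $f$ is normalized if $f(u,v)=\mathrm{id}$ for all edges $\{u,v\}$ of some spanning tree of $Y$. Denote by $\langle f\rangle$ the subgroup of $\mathrm{Sym}(r)$ generated by the (non-zero) values of $f$. Standing assumptions: $f$ is normalized and $\langle f\rangle$ acts regularly (i.e. simply transitively) on $\{1,\dots,r\}$. The cover is called cyclic if $\langle f\rangle$ is a cyclic group. Two-eigenvalue cover (2ev-cover): $\mathrm{Spec}(A)$ denotes the spectrum of $A$ as a multiset, and $A(\cdot)$ the adjacency matrix. One has $\mathrm{Spec}(A(Y))\subseteq\mathrm{Spec}(A(Y^f))$ as multisets, and $Y^f$ is a 2ev-cover of $Y$ if the multiset difference $\mathrm{Spec}(A(Y^f))\setminus\mathrm{Spec}(A(Y))$ has exactly two distinct elements. A graph with adjacency matrix $A$ is walk regular if $A^k$ has constant diagonal for every positive integer $k$. *)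

theory Defs
  imports
    "HOL-Algebra.Sym_Groups"
    "HOL-Algebra.Elementary_Groups"
    "Graph_Theory.Digraph_Component"
    "Jordan_Normal_Form.Char_Poly"
begin

text \<open>Finite simple undirected graphs are the symmetric loop-free finite digraphs
  \<^locale>\<open>pair_graph\<close> of the Graph Theory entry: an edge is a pair of opposite arcs.\<close>

text \<open>The library's \<^const>\<open>spanning_tree\<close> is not used: its \<^const>\<open>forest\<close> only excludes directed
  cycles (so any acyclic orientation of a connected graph would be a tree), and counts
  the two arcs of one edge as a cycle.\<close>

definition undirected_tree :: "'a pair_pre_digraph \<Rightarrow> bool" where
  "undirected_tree T \<longleftrightarrow> pair_graph T \<and> Digraph_Component.connected (with_proj T) \<and>
     \<not> (\<exists>p. pre_digraph.cycle (with_proj T) p \<and> length p \<ge> 3)"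

definition undirected_spanning_tree :: "'a pair_pre_digraph \<Rightarrow> 'a pair_pre_digraph \<Rightarrow> bool" where
  "undirected_spanning_tree T Y \<longleftrightarrow>
     undirected_tree T \<and> spanning (with_proj T) (with_proj Y)"

text \<open>The extra value $0$ of an arc function is represented by \<^const>\<open>None\<close>.\<close>

definition symmetric_arc_function ::
  "'a pair_pre_digraph \<Rightarrow> nat \<Rightarrow> (nat \<Rightarrow> nat) set \<Rightarrow> ('a \<Rightarrow> 'a \<Rightarrow> (nat \<Rightarrow> nat) option) \<Rightarrow> bool" where
  "symmetric_arc_function Y r G f \<longleftrightarrow>
     (\<forall>u \<in> pverts Y. \<forall>v \<in> pverts Y.
        f u v \<in> insert None (Some ` G) \<and>
        (f u v = None \<longleftrightarrow> (u, v) \<notin> parcs Y) \<and>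
        (f u v \<noteq> None \<longrightarrow> f u v = map_option (\<lambda>g. inv\<^bsub>sym_group r\<^esub> g) (f v u)))"

definition cover ::
  "'a pair_pre_digraph \<Rightarrow> nat \<Rightarrow> ('a \<Rightarrow> 'a \<Rightarrow> (nat \<Rightarrow> nat) option) \<Rightarrow> ('a \<times> nat) pair_pre_digraph" where
  "cover Y r f =
     \<lparr> pverts = pverts Y \<times> {1..r},
       parcs = {((v, j), (u, k)) | v j u k.
         j \<in> {1..r} \<and> k \<in> {1..r} \<and> (v, u) \<in> parcs Y \<and> (\<exists>g. f u v = Some g \<and> g j = k)} \<rparr>"

definition normalized ::
  "'a pair_pre_digraph \<Rightarrow> ('a \<Rightarrow> 'a \<Rightarrow> (nat \<Rightarrow> nat) option) \<Rightarrow> bool" where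
  "normalized Y f \<longleftrightarrow>
     (\<exists>T. undirected_spanning_tree T Y \<and> (\<forall>(u, v) \<in> parcs T. f u v = Some id))"

definition arc_function_group ::
  "'a pair_pre_digraph \<Rightarrow> nat \<Rightarrow> ('a \<Rightarrow> 'a \<Rightarrow> (nat \<Rightarrow> nat) option) \<Rightarrow> (nat \<Rightarrow> nat) monoid" where
  "arc_function_group Y r f =
     subgroup_generated (sym_group r) {g. \<exists>u \<in> pverts Y. \<exists>v \<in> pverts Y. f u v = Some g}"

definition acts_regularly :: "('b \<Rightarrow> 'b) set \<Rightarrow> 'b set \<Rightarrow> bool" where
  "acts_regularly H S \<longleftrightarrow> (\<forall>i \<in> S. \<forall>j \<in> S. \<exists>!g. g \<in> H \<and> g i = j)"

text \<open>Library matrices have index set $\{0,\dots,n-1\}$, so a numbering of the vertices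
  is chosen. The spectrum and walk regularity do not depend on it.\<close>

definition vertex_list :: "'a pair_pre_digraph \<Rightarrow> 'a list" where
  "vertex_list Y = (SOME vs. distinct vs \<and> set vs = pverts Y)"

definition adjacency_matrix :: "'a pair_pre_digraph \<Rightarrow> complex mat" where
  "adjacency_matrix Y = (let vs = vertex_list Y; n = length vs in
     mat n n (\<lambda>(i, j). if (vs ! i, vs ! j) \<in> parcs Y then 1 else 0))"

text \<open>Eigenvalues with their algebraic multiplicities.\<close>

definition spec_mset :: "complex mat \<Rightarrow> complex multiset" where
  "spec_mset A = proots (char_poly A)"

definition two_ev_cover ::
  "'a pair_pre_digraph \<Rightarrow> nat \<Rightarrow> ('a \<Rightarrow> 'a \<Rightarrow> (nat \<Rightarrow> nat) option) \<Rightarrow> bool" where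
  "two_ev_cover Y r f \<longleftrightarrow>
     card (set_mset (spec_mset (adjacency_matrix (cover Y r f))
                       - spec_mset (adjacency_matrix Y))) = 2"

definition walk_regular :: "'a pair_pre_digraph \<Rightarrow> bool" where
  "walk_regular Y \<longleftrightarrow> (let A = adjacency_matrix Y in
     \<forall>k::nat. k > 0 \<longrightarrow> (\<exists>c. \<forall>i < dim_row A. (A ^\<^sub>m k) $$ (i, i) = c))"

end

theory Submission
  imports Defs "Jordan_Normal_Form.Schur_Decomposition"
begin

text \<open>Let $A$ and $B$ be the adjacency matrices of the cover and of $Y$, let $\theta, \tau$ be the
  new eigenvalues, and put $q(x) = (x - \theta)(x - \tau)$. For a matrix $M$ on the vertices of $Y$
  let $L(M)$ be its pull-back to the cover divided by $r$; then $L(M) A = L(M B)$ and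
  $\mathrm{tr}\, L(M) = \mathrm{tr}\, M$. Hence
  $\mathrm{tr}\, (q(A) - L(q(B)))^2 = \mathrm{tr}\, q(A)^2 - \mathrm{tr}\, q(B)^2$, which is the sum
  of $q^2$ over $\mathrm{Spec}(A) - \mathrm{Spec}(B)$, where it vanishes, minus the sum of $q^2 \geq 0$
  over $\mathrm{Spec}(B) - \mathrm{Spec}(A)$. A real symmetric matrix whose square has trace
  $\leq 0$ is zero, so $q(A) = L(q(B))$. By induction every power satisfies
  $A^k = a A + b I + L(B^k - a B - b I)$ for some scalars $a, b$, and the diagonal of the right-hand side is constant.\<close>

section \<open>Traces and quadratic polynomials of matrices\<close>

lemma index_mult_mat_sum:
  assumes "A \<in> carrier_mat m n" "B \<in> carrier_mat n k" "i < m" "j < k"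
  shows "(A * B) $$ (i, j) = (\<Sum>l<n. A $$ (i, l) * B $$ (l, j))"
  using assms by (auto simp: scalar_prod_def lessThan_atLeast0)

definition mat_trace :: "'a :: comm_monoid_add mat \<Rightarrow> 'a" where
  "mat_trace A = (\<Sum>i<dim_row A. A $$ (i, i))"

lemma mat_trace_minus:
  fixes A :: "'a :: ab_group_add mat"
  shows "A \<in> carrier_mat n n \<Longrightarrow> B \<in> carrier_mat n n \<Longrightarrow> mat_trace (A - B) = mat_trace A - mat_trace B"
  by (auto simp: mat_trace_def sum_subtractf)

lemma mat_trace_mult_commute:
  fixes A B :: "'a :: comm_semiring_0 mat"
  assumes A: "A \<in> carrier_mat m n" and B: "B \<in> carrier_mat n m"
  shows "mat_trace (A * B) = mat_trace (B * A)"
proof -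
  have "mat_trace (A * B) = (\<Sum>i<m. \<Sum>l<n. A $$ (i, l) * B $$ (l, i))"
    using A B by (simp add: mat_trace_def index_mult_mat_sum del: index_mult_mat(1))
  also have "\<dots> = (\<Sum>l<n. \<Sum>i<m. B $$ (l, i) * A $$ (i, l))"
    by (subst sum.swap) (simp add: mult.commute)
  also have "\<dots> = mat_trace (B * A)"
    using A B by (simp add: mat_trace_def index_mult_mat_sum del: index_mult_mat(1))
  finally show ?thesis .
qed

text \<open>For \<open>s = - (\<theta> + \<tau>)\<close> and \<open>p = \<theta> * \<tau>\<close>
  this is q(A) = (A - \<theta> I)(A - \<tau> I).\<close>

definition quad_mat :: "'a :: ring_1 \<Rightarrow> 'a \<Rightarrow> 'a mat \<Rightarrow> 'a mat" where
  "quad_mat s p A = A * A + s \<cdot>\<^sub>m A + p \<cdot>\<^sub>m 1\<^sub>m (dim_row A)"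

lemma quad_mat_carrier [simp]: "A \<in> carrier_mat n n \<Longrightarrow> quad_mat s p A \<in> carrier_mat n n"
  unfolding quad_mat_def by auto

text \<open>In the square of P B Q the inner factor Q P cancels, and I = P I Q. The witnesses P and
  Q stay the same, so a triangularisation of A also triangularises q(A).\<close>

lemma quad_mat_similar:
  fixes A :: "'a :: comm_ring_1 mat"
  assumes A: "A \<in> carrier_mat n n" and sim: "similar_mat_wit A B P Q"
  shows "similar_mat_wit (quad_mat s p A) (quad_mat s p B) P Q"
proof -
  note w = similar_mat_witD2[OF A sim]
  have B: "B \<in> carrier_mat n n" and P: "P \<in> carrier_mat n n" and Q: "Q \<in> carrier_mat n n"
    and PQ: "P * Q = 1\<^sub>m n" and QP: "Q * P = 1\<^sub>m n" and AP: "A = P * B * Q"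
    using w by auto
  have "A * A = P * (B * ((Q * P) * (B * Q)))"
    unfolding AP using B P Q by (simp add: assoc_mult_mat[of _ n n _ n _ n])
  also have "\<dots> = P * (B * B) * Q"
    unfolding QP using B P Q by (simp add: assoc_mult_mat[of _ n n _ n _ n])
  finally have AA: "A * A = P * (B * B) * Q" .
  have sA: "s \<cdot>\<^sub>m A = P * (s \<cdot>\<^sub>m B) * Q"
    unfolding AP using B P Q
    by (simp add: mult_smult_distrib[of _ n n _ n] mult_smult_assoc_mat[of _ n n _ n])
  have pI: "p \<cdot>\<^sub>m 1\<^sub>m n = P * (p \<cdot>\<^sub>m 1\<^sub>m n) * Q"
    using P Q by (simp add: mult_smult_distrib[of _ n n _ n] mult_smult_assoc_mat[of _ n n _ n] PQ)
  have "quad_mat s p A = P * quad_mat s p B * Q"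
  proof -
    have "P * quad_mat s p B * Q = P * (B * B) * Q + P * (s \<cdot>\<^sub>m B) * Q + P * (p \<cdot>\<^sub>m 1\<^sub>m n) * Q"
      using B P Q unfolding quad_mat_def
      by (simp add: mult_add_distrib_mat[of _ n n _ n] add_mult_distrib_mat[of _ n n _ _ n])
    then show ?thesis using A AA sA pI unfolding quad_mat_def by simp
  qed
  then show ?thesis
    using A B P Q PQ QP unfolding similar_mat_wit_def Let_def by auto
qed

text \<open>Cyclicity of the trace moves P to the right end of P (B B) Q, where it meets Q and
  cancels.\<close>

lemma mat_trace_similar_sq:
  fixes A :: "'a :: comm_ring_1 mat"
  assumes A: "A \<in> carrier_mat n n" and sim: "similar_mat_wit A B P Q"
  shows "mat_trace (A * A) = mat_trace (B * B)"
proof -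
  note w = similar_mat_witD2[OF A sim]
  have B: "B \<in> carrier_mat n n" and P: "P \<in> carrier_mat n n" and Q: "Q \<in> carrier_mat n n"
    and PQ: "P * Q = 1\<^sub>m n" and QP: "Q * P = 1\<^sub>m n" and AP: "A = P * B * Q"
    using w by auto
  have "A * A = P * (B * ((Q * P) * (B * Q)))"
    unfolding AP using B P Q by (simp add: assoc_mult_mat[of _ n n _ n _ n])
  also have "\<dots> = P * (B * B * Q)"
    unfolding QP using B P Q by (simp add: assoc_mult_mat[of _ n n _ n _ n])
  finally have "mat_trace (A * A) = mat_trace ((B * B * Q) * P)"
    using mat_trace_mult_commute[of P n n "B * B * Q"] B P Q by simp
  also have "(B * B * Q) * P = B * B"
    using B P Q by (simp add: assoc_mult_mat[of _ n n _ n _ n] QP)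
  finally show ?thesis .
qed

section \<open>The trace of q(A)^2 in terms of the spectrum\<close>

lemma upper_triangular_mult_diag:
  fixes A B :: "'a :: semiring_0 mat"
  assumes "A \<in> carrier_mat n n" "B \<in> carrier_mat n n"
    and "upper_triangular A" "upper_triangular B" "i < n"
  shows "(A * B) $$ (i, i) = A $$ (i, i) * B $$ (i, i)"
proof -
  have "(A * B) $$ (i, i) = (\<Sum>l<n. A $$ (i, l) * B $$ (l, i))"
    using assms by (simp add: index_mult_mat_sum del: index_mult_mat(1))
  \<comment> \<open>For l < i the factor from A lies below the diagonal, for l > i the factor from B
    does.\<close>
  also have "\<dots> = (\<Sum>l<n. if l = i then A $$ (i, i) * B $$ (i, i) else 0)"
  proof (rule sum.cong)
    fix l assume "l \<in> {..<n}"
    then show "A $$ (i, l) * B $$ (l, i) = (if l = i then A $$ (i, i) * B $$ (i, i) else 0)"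
      using assms upper_triangularD[of A l i] upper_triangularD[of B i l]
      by (cases l i rule: linorder_cases) auto
  qed simp
  also have "\<dots> = A $$ (i, i) * B $$ (i, i)" using assms by simp
  finally show ?thesis .
qed

lemma upper_triangular_mult:
  fixes A B :: "'a :: semiring_0 mat"
  assumes "A \<in> carrier_mat n n" "B \<in> carrier_mat n n"
    and "upper_triangular A" "upper_triangular B"
  shows "upper_triangular (A * B)"
proof (rule upper_triangularI)
  fix i j assume ij: "j < i" "i < dim_row (A * B)"
  have "A $$ (i, l) * B $$ (l, j) = 0" if "l < n" for l
    using that ij assms upper_triangularD[of A l i] upper_triangularD[of B j l]
    by (cases "l < i") auto
  then show "(A * B) $$ (i, j) = 0"
    using ij assms by (simp add: index_mult_mat_sum del: index_mult_mat(1))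
qed

text \<open>Products of upper triangular matrices are upper triangular and multiply their diagonals
  entrywise, so each diagonal entry e becomes q(e)^2.\<close>

lemma mat_trace_quad_sq_upper_triangular:
  fixes B :: "'a :: comm_ring_1 mat"
  assumes B: "B \<in> carrier_mat n n" and ut: "upper_triangular B"
  shows "mat_trace (quad_mat s p B * quad_mat s p B) = (\<Sum>e\<leftarrow>diag_mat B. (e\<^sup>2 + s * e + p)\<^sup>2)"
proof -
  have ut2: "upper_triangular (quad_mat s p B)"
  proof (rule upper_triangularI)
    fix i j assume "j < i" "i < dim_row (quad_mat s p B)"
    then show "quad_mat s p B $$ (i, j) = 0"
      using B upper_triangularD[OF upper_triangular_mult[OF B B ut ut], of j i]
        upper_triangularD[OF ut, of j i]
      by (simp add: quad_mat_def del: index_mult_mat(1))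
  qed
  have d: "(quad_mat s p B * quad_mat s p B) $$ (i, i)
      = ((B $$ (i, i))\<^sup>2 + s * B $$ (i, i) + p)\<^sup>2" if "i < n" for i
  proof -
    have "quad_mat s p B $$ (i, i) = (B $$ (i, i))\<^sup>2 + s * B $$ (i, i) + p"
      using that B upper_triangular_mult_diag[OF B B ut ut that]
      by (simp add: quad_mat_def power2_eq_square del: index_mult_mat(1))
    then show ?thesis
      using upper_triangular_mult_diag[OF quad_mat_carrier[OF B] quad_mat_carrier[OF B] ut2 ut2 that]
      by (simp add: power2_eq_square)
  qed
  have "mat_trace (quad_mat s p B * quad_mat s p B)
      = (\<Sum>i<n. ((B $$ (i, i))\<^sup>2 + s * B $$ (i, i) + p)\<^sup>2)"
    using d carrier_matD[OF quad_mat_carrier[OF B, of s p]] by (simp add: mat_trace_def del: index_mult_mat(1))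
  also have "\<dots> = (\<Sum>e\<leftarrow>diag_mat B. (e\<^sup>2 + s * e + p)\<^sup>2)"
    using B by (simp add: diag_mat_def sum_list_distinct_conv_sum_set comp_def lessThan_atLeast0)
  finally show ?thesis .
qed

text \<open>Reads off \<open>spec_mset\<close>, with multiplicities, from a factored characteristic
  polynomial.\<close>

lemma proots_prod_list_linear:
  "proots (\<Prod>e\<leftarrow>es. [:- e, 1:]) = mset (es :: 'a :: idom list)"
proof (induction es)
  case (Cons e es)
  have "(\<Prod>e\<leftarrow>es. [:- e, 1:]) \<noteq> 0" by (auto simp: prod_list_zero_iff)
  with Cons show ?case by (simp add: proots_mult del: mult_pCons_left)
qed simp

text \<open>Over the complex numbers the characteristic polynomial splits, and a Schur decomposition
  gives a similar upper triangular matrix with the eigenvalues on its diagonal. The triangular case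
  then applies; no diagonalisation is involved.\<close>

lemma mat_trace_quad_sq:
  assumes A: "A \<in> carrier_mat n n"
  shows "mat_trace (quad_mat s p A * quad_mat s p A) = (\<Sum>e\<in>#spec_mset A. (e\<^sup>2 + s * e + p)\<^sup>2)"
proof -
  obtain es where es: "char_poly A = (\<Prod>e\<leftarrow>es. [:- e, 1:])"
    using char_poly_factorized[OF A] by blast
  obtain B P Q where "schur_decomposition A es = (B, P, Q)" by (cases "schur_decomposition A es")
  from schur_decomposition[OF A es this]
  have sim: "similar_mat_wit A B P Q" and ut: "upper_triangular B" and dB: "diag_mat B = es" by auto
  have B: "B \<in> carrier_mat n n" using similar_mat_witD2[OF A sim] by simp
  have "mat_trace (quad_mat s p A * quad_mat s p A) = mat_trace (quad_mat s p B * quad_mat s p B)"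
    by (rule mat_trace_similar_sq[OF quad_mat_carrier[OF A] quad_mat_similar[OF A sim]])
  also have "\<dots> = (\<Sum>e\<in>#mset es. (e\<^sup>2 + s * e + p)\<^sup>2)"
    unfolding mat_trace_quad_sq_upper_triangular[OF B ut] dB
    by (simp only: mset_map[symmetric] sum_mset_sum_list)
  finally show ?thesis by (simp add: spec_mset_def es proots_prod_list_linear)
qed

section \<open>Real symmetric matrices with complex entry type\<close>

definition real_symmetric :: "complex mat \<Rightarrow> bool" where
  "real_symmetric A \<longleftrightarrow> A\<^sup>T = A \<and> (\<forall>i<dim_row A. \<forall>j<dim_col A. A $$ (i, j) \<in> \<real>)"

text \<open>For an eigenvector v with squared norm N, the Hermitian form of A at v equals both e N
  and \<open>cnj e * N\<close>, and N is nonzero.\<close>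

lemma real_symmetric_spec:
  assumes A: "A \<in> carrier_mat n n" and S: "real_symmetric A" and e: "e \<in># spec_mset A"
  shows "e \<in> \<real>"
proof -
  have "char_poly A \<noteq> 0" using degree_monic_char_poly[OF A] by auto
  then have "poly (char_poly A) e = 0" using e unfolding spec_mset_def by simp
  then have "eigenvalue A e" using eigenvalue_root_char_poly[OF A] by simp
  then obtain v where v: "v \<in> carrier_vec n" "v \<noteq> 0\<^sub>v n" and Av: "A *\<^sub>v v = e \<cdot>\<^sub>v v"
    using A unfolding eigenvalue_def eigenvector_def by auto
  have row: "(\<Sum>j<n. A $$ (i, j) * v $ j) = e * v $ i" if "i < n" for i
    using arg_cong[OF Av, of "\<lambda>w. w $ i"] that A v
    by (simp add: scalar_prod_def lessThan_atLeast0)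
  have sym: "A $$ (i, j) = A $$ (j, i)" if "i < n" "j < n" for i j
    using S that A unfolding real_symmetric_def by (metis carrier_matD index_transpose_mat(1))
  have re: "cnj (A $$ (i, j)) = A $$ (i, j)" if "i < n" "j < n" for i j
    using S that A unfolding real_symmetric_def by (auto simp: Reals_cnj_iff)
  define N where "N = (\<Sum>i<n. v $ i * cnj (v $ i))"
  have "e * N = (\<Sum>i<n. (\<Sum>j<n. A $$ (i, j) * v $ j) * cnj (v $ i))"
    unfolding N_def using row by (simp add: sum_distrib_left mult.assoc)
  also have "\<dots> = (\<Sum>j<n. \<Sum>i<n. A $$ (i, j) * v $ j * cnj (v $ i))"
    by (subst sum.swap) (simp add: sum_distrib_right)
  \<comment> \<open>Symmetry and realness replace A(i,j) by the conjugate of A(j,i), which turns the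
    inner sum into the conjugate of entry j of A v.\<close>
  also have "\<dots> = (\<Sum>j<n. v $ j * cnj (\<Sum>i<n. A $$ (j, i) * v $ i))"
    using sym re by (intro sum.cong refl) (simp add: sum_distrib_left mult_ac)
  also have "\<dots> = cnj e * N"
    unfolding N_def using row by (simp add: sum_distrib_left mult_ac)
  finally have eq: "e * N = cnj e * N" .
  have "N = of_real (\<Sum>i<n. (cmod (v $ i))\<^sup>2)"
    unfolding N_def of_real_sum
    by (intro sum.cong refl complex_norm_square[symmetric])
  moreover have "(\<Sum>i<n. (cmod (v $ i))\<^sup>2) \<noteq> 0"
  proof
    assume "(\<Sum>i<n. (cmod (v $ i))\<^sup>2) = 0"
    then have "\<forall>i<n. v $ i = 0" by (simp add: sum_nonneg_eq_0_iff)
    then show False using v by (auto simp: vec_eq_iff)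
  qed
  ultimately have "N \<noteq> 0" by (simp only: of_real_eq_0_iff not_False_eq_True)
  with eq show ?thesis by (simp add: Reals_cnj_iff)
qed

text \<open>For a real symmetric matrix the trace of the square is the sum of the squares of all
  entries.\<close>

lemma real_symmetric_mat_trace_sq_eq_0:
  assumes A: "A \<in> carrier_mat n n" and S: "real_symmetric A" and tr: "Re (mat_trace (A * A)) \<le> 0"
  shows "A = 0\<^sub>m n n"
proof -
  have sq: "Re (A $$ (i, j) * A $$ (j, i)) = (Re (A $$ (i, j)))\<^sup>2" if "i < n" "j < n" for i j
  proof -
    have "A $$ (j, i) = A $$ (i, j)"
      using S that A unfolding real_symmetric_def by (metis carrier_matD index_transpose_mat(1))
    moreover have "A $$ (i, j) \<in> \<real>" using S that A unfolding real_symmetric_def by auto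
    ultimately show ?thesis by (simp add: complex_is_Real_iff power2_eq_square)
  qed
  have "Re (mat_trace (A * A)) = (\<Sum>i<n. \<Sum>j<n. (Re (A $$ (i, j)))\<^sup>2)"
    using A sq by (simp add: mat_trace_def index_mult_mat_sum del: index_mult_mat(1) times_complex.sel(1))
  with tr have "(\<Sum>i<n. \<Sum>j<n. (Re (A $$ (i, j)))\<^sup>2) = 0"
    by (simp add: antisym sum_nonneg)
  then have z: "Re (A $$ (i, j)) = 0" if "i < n" "j < n" for i j
    using that by (simp add: sum_nonneg_eq_0_iff sum_nonneg)
  show ?thesis
  proof (rule eq_matI)
    fix i j assume "i < dim_row (0\<^sub>m n n)" "j < dim_col (0\<^sub>m n n)"
    then have ij: "i < n" "j < n" by auto
    have "A $$ (i, j) \<in> \<real>" using S ij A unfolding real_symmetric_def by auto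
    then show "A $$ (i, j) = 0\<^sub>m n n $$ (i, j)"
      using z[OF ij] ij by (simp add: complex_is_Real_iff complex_eq_iff)
  qed (use A in auto)
qed

lemma real_symmetric_add:
  "A \<in> carrier_mat n n \<Longrightarrow> B \<in> carrier_mat n n \<Longrightarrow> real_symmetric A \<Longrightarrow> real_symmetric B
    \<Longrightarrow> real_symmetric (A + B)"
  unfolding real_symmetric_def by (auto simp: transpose_add[of _ n n])

lemma real_symmetric_minus:
  "A \<in> carrier_mat n n \<Longrightarrow> B \<in> carrier_mat n n \<Longrightarrow> real_symmetric A \<Longrightarrow> real_symmetric B
    \<Longrightarrow> real_symmetric (A - B)"
  unfolding real_symmetric_def by (auto simp: transpose_minus[of _ n n])

lemma real_symmetric_smult:
  assumes "real_symmetric A" "c \<in> \<real>"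
  shows "real_symmetric (c \<cdot>\<^sub>m A)"
proof -
  have "(c \<cdot>\<^sub>m A)\<^sup>T = c \<cdot>\<^sub>m A\<^sup>T" by (rule eq_matI) auto
  then show ?thesis using assms unfolding real_symmetric_def by auto
qed

lemma real_symmetric_quad_mat:
  assumes A: "A \<in> carrier_mat n n" and S: "real_symmetric A" and "s \<in> \<real>" "p \<in> \<real>"
  shows "real_symmetric (quad_mat s p A)"
proof -
  have "(A * A) $$ (i, j) \<in> \<real>" if "i < n" "j < n" for i j
    using that A S unfolding real_symmetric_def
    by (auto simp: index_mult_mat_sum simp del: index_mult_mat(1) intro!: sum_in_Reals Reals_mult)
  then have 1: "real_symmetric (A * A)"
    using A S unfolding real_symmetric_def by (auto simp: transpose_mult[of _ n n _ n] simp del: index_mult_mat(1))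
  have 2: "real_symmetric (s \<cdot>\<^sub>m A)"
    using real_symmetric_smult[OF S \<open>s \<in> \<real>\<close>] .
  have 3: "real_symmetric (p \<cdot>\<^sub>m 1\<^sub>m n)"
    using real_symmetric_smult[OF _ \<open>p \<in> \<real>\<close>, of "1\<^sub>m n"] by (auto simp: real_symmetric_def)
  show ?thesis
    using A unfolding quad_mat_def
    by (auto intro!: real_symmetric_add[of _ n] 1 2 3)
qed

lemma Re_sum_mset_nonneg: "(\<And>x. x \<in># M \<Longrightarrow> 0 \<le> Re (g x)) \<Longrightarrow> 0 \<le> Re (\<Sum>x\<in>#M. g x)"
  by (induction M) auto

text \<open>One step of reduction modulo q(x) = x^2 + s x + p: if x^k is congruent to a x + b, then
  x^(k+1) is congruent to a x^2 + b x, hence to (b - a s) x - a p. The identity keeps the error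
  terms explicit and holds for any scalars, so it can be used for A and B with the same
  ones.\<close>

lemma pow_mat_Suc_mod_quad:
  fixes M :: "'a :: comm_ring_1 mat"
  assumes M: "M \<in> carrier_mat n n"
  shows "M ^\<^sub>m Suc k - ((b - a * s) \<cdot>\<^sub>m M + (- (a * p)) \<cdot>\<^sub>m 1\<^sub>m n)
    = (M ^\<^sub>m k - (a \<cdot>\<^sub>m M + b \<cdot>\<^sub>m 1\<^sub>m n)) * M + a \<cdot>\<^sub>m quad_mat s p M"
proof -
  have "(M ^\<^sub>m k - (a \<cdot>\<^sub>m M + b \<cdot>\<^sub>m 1\<^sub>m n)) * M = M ^\<^sub>m k * M - (a \<cdot>\<^sub>m (M * M) + b \<cdot>\<^sub>m M)"
    using M by (simp add: minus_mult_distrib_mat[of _ n n _ _ n] add_mult_distrib_mat[of _ n n _ _ n]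
        mult_smult_assoc_mat[of _ n n _ n])
  then show ?thesis
    unfolding quad_mat_def using M
    by (intro eq_matI) (auto simp: algebra_simps simp del: index_mult_mat(1))
qed

section \<open>Lifting matrices along a map with fibres of equal size\<close>

locale fibre_map =
  fixes N n r :: nat and \<pi> :: "nat \<Rightarrow> nat"
  assumes fibre_map_less: "k < N \<Longrightarrow> \<pi> k < n"
    and card_fibre: "v < n \<Longrightarrow> card {k \<in> {..<N}. \<pi> k = v} = r"
    and fibre_size_pos: "0 < r"
begin

text \<open>Let P be the N x n incidence matrix of \<open>\<pi>\<close>, so that P^T P = r I. The
  lift is P M P^T / r; the factor 1/r makes it preserve traces and products. The identity is sent to
  the projection onto vectors constant on fibres.\<close>

definition lift_mat :: "complex mat \<Rightarrow> complex mat" where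
  "lift_mat M = mat N N (\<lambda>(i, j). M $$ (\<pi> i, \<pi> j) / of_nat r)"

text \<open>In terms of P the condition says P^T A = B P^T: the fibres form an equitable partition
  with quotient B. Summing over the row index of A fits multiplication of lifts by A from the
  right.\<close>

definition equitable :: "complex mat \<Rightarrow> complex mat \<Rightarrow> bool" where
  "equitable A B \<longleftrightarrow> A \<in> carrier_mat N N \<and> B \<in> carrier_mat n n \<and>
     (\<forall>v<n. \<forall>j<N. (\<Sum>k\<in>{k \<in> {..<N}. \<pi> k = v}. A $$ (k, j)) = B $$ (v, \<pi> j))"

lemma lift_mat_carrier [simp]: "lift_mat M \<in> carrier_mat N N"
  unfolding lift_mat_def by simp

lemma index_lift_mat [simp]: "i < N \<Longrightarrow> j < N \<Longrightarrow> lift_mat M $$ (i, j) = M $$ (\<pi> i, \<pi> j) / of_nat r"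
  unfolding lift_mat_def by simp

lemma dim_lift_mat [simp]: "dim_row (lift_mat M) = N" "dim_col (lift_mat M) = N"
  unfolding lift_mat_def by simp_all

lemma sum_fibres:
  fixes h :: "nat \<Rightarrow> complex"
  shows "(\<Sum>k<N. h k) = (\<Sum>v<n. \<Sum>k\<in>{k \<in> {..<N}. \<pi> k = v}. h k)"
  by (rule sum.group[symmetric]) (auto simp: fibre_map_less)

lemma sum_fibres_const:
  fixes h :: "nat \<Rightarrow> complex"
  shows "(\<Sum>k<N. h (\<pi> k)) = of_nat r * (\<Sum>v<n. h v)"
  unfolding sum_fibres sum_distrib_left
proof (intro sum.cong refl)
  fix v assume "v \<in> {..<n}"
  then show "(\<Sum>k\<in>{k \<in> {..<N}. \<pi> k = v}. h (\<pi> k)) = of_nat r * h v"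
    using card_fibre[of v] by simp
qed

lemma mat_trace_lift_mat: "M \<in> carrier_mat n n \<Longrightarrow> mat_trace (lift_mat M) = mat_trace M"
  using sum_fibres_const[of "\<lambda>v. M $$ (v, v)"] fibre_size_pos
  by (auto simp: mat_trace_def sum_divide_distrib[symmetric])

lemma lift_mat_add:
  assumes "M \<in> carrier_mat n n" "M' \<in> carrier_mat n n"
  shows "lift_mat (M + M') = lift_mat M + lift_mat M'"
  using assms by (intro eq_matI) (auto simp: fibre_map_less add_divide_distrib)

lemma lift_mat_smult: "M \<in> carrier_mat n n \<Longrightarrow> lift_mat (c \<cdot>\<^sub>m M) = c \<cdot>\<^sub>m lift_mat M"
  by (intro eq_matI) (auto simp: fibre_map_less)

text \<open>P M P^T A = P M B P^T. In entries, the sum over k is grouped into fibres, on which the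
  factor from M is constant.\<close>

lemma lift_mat_mult:
  assumes M: "M \<in> carrier_mat n n" and E: "equitable A B"
  shows "lift_mat M * A = lift_mat (M * B)"
proof (rule eq_matI)
  have A: "A \<in> carrier_mat N N" and B: "B \<in> carrier_mat n n" using E unfolding equitable_def by auto
  fix i j assume "i < dim_row (lift_mat (M * B))" "j < dim_col (lift_mat (M * B))"
  then have ij: "i < N" "j < N" by auto
  have "(lift_mat M * A) $$ (i, j) = (\<Sum>k<N. M $$ (\<pi> i, \<pi> k) / of_nat r * A $$ (k, j))"
    using ij A by (simp add: index_mult_mat_sum[of _ N N _ N] del: index_mult_mat(1))
  also have "\<dots> = (\<Sum>v<n. M $$ (\<pi> i, v) / of_nat r * (\<Sum>k\<in>{k \<in> {..<N}. \<pi> k = v}. A $$ (k, j)))"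
    unfolding sum_fibres sum_distrib_left by (intro sum.cong refl) auto
  also have "\<dots> = (\<Sum>v<n. M $$ (\<pi> i, v) * B $$ (v, \<pi> j)) / of_nat r"
    unfolding sum_divide_distrib using E ij unfolding equitable_def by (intro sum.cong refl) auto
  also have "\<dots> = lift_mat (M * B) $$ (i, j)"
    using ij M B by (simp add: index_mult_mat_sum[of _ n n _ n] fibre_map_less del: index_mult_mat(1))
  finally show "(lift_mat M * A) $$ (i, j) = lift_mat (M * B) $$ (i, j)" .
qed (use E in \<open>auto simp: equitable_def\<close>)

text \<open>Intertwining relations compose: P^T A A' = B P^T A' = B B' P^T.\<close>

lemma equitable_mult:
  assumes E: "equitable A B" and E': "equitable A' B'"
  shows "equitable (A * A') (B * B')"
  unfolding equitable_def
proof (intro conjI allI impI)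
  have A: "A \<in> carrier_mat N N" and B: "B \<in> carrier_mat n n" using E unfolding equitable_def by auto
  have A': "A' \<in> carrier_mat N N" and B': "B' \<in> carrier_mat n n" using E' unfolding equitable_def by auto
  show "A * A' \<in> carrier_mat N N" "B * B' \<in> carrier_mat n n" using A A' B B' by auto
  fix v j assume v: "v < n" and j: "j < N"
  have "(\<Sum>k\<in>{k \<in> {..<N}. \<pi> k = v}. (A * A') $$ (k, j))
      = (\<Sum>k\<in>{k \<in> {..<N}. \<pi> k = v}. \<Sum>l<N. A $$ (k, l) * A' $$ (l, j))"
    using A A' j by (intro sum.cong refl) (auto simp: index_mult_mat_sum[of _ N N _ N] simp del: index_mult_mat(1))
  also have "\<dots> = (\<Sum>l<N. (\<Sum>k\<in>{k \<in> {..<N}. \<pi> k = v}. A $$ (k, l)) * A' $$ (l, j))"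
    by (subst sum.swap) (simp add: sum_distrib_right)
  also have "\<dots> = (\<Sum>l<N. B $$ (v, \<pi> l) * A' $$ (l, j))"
    using E v unfolding equitable_def by (intro sum.cong refl) auto
  also have "\<dots> = (\<Sum>w<n. B $$ (v, w) * (\<Sum>l\<in>{l \<in> {..<N}. \<pi> l = w}. A' $$ (l, j)))"
    unfolding sum_fibres sum_distrib_left by (intro sum.cong refl) auto
  also have "\<dots> = (\<Sum>w<n. B $$ (v, w) * B' $$ (w, \<pi> j))"
    using E' j unfolding equitable_def by (intro sum.cong refl) auto
  also have "\<dots> = (B * B') $$ (v, \<pi> j)"
    using B B' v j by (simp add: index_mult_mat_sum[of _ n n _ n] fibre_map_less del: index_mult_mat(1))
  finally show "(\<Sum>k\<in>{k \<in> {..<N}. \<pi> k = v}. (A * A') $$ (k, j)) = (B * B') $$ (v, \<pi> j)" .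
qed

lemma equitable_quad_mat:
  assumes E: "equitable A B"
  shows "equitable (quad_mat s p A) (quad_mat s p B)"
  unfolding equitable_def
proof (intro conjI allI impI)
  have A: "A \<in> carrier_mat N N" and B: "B \<in> carrier_mat n n" using E unfolding equitable_def by auto
  then show "quad_mat s p A \<in> carrier_mat N N" "quad_mat s p B \<in> carrier_mat n n" by auto
  fix v j assume v: "v < n" and j: "j < N"
  let ?F = "{k \<in> {..<N}. \<pi> k = v}"
  have "(\<Sum>k\<in>?F. quad_mat s p A $$ (k, j))
      = (\<Sum>k\<in>?F. (A * A) $$ (k, j) + s * A $$ (k, j) + (if k = j then p else 0))"
    using A j unfolding quad_mat_def by (intro sum.cong refl) (auto simp del: index_mult_mat(1))
  \<comment> \<open>Column j meets the diagonal in row j, which lies in the fibre of v exactly when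
    \<open>\<pi> j = v\<close>.\<close>
  also have "\<dots> = (\<Sum>k\<in>?F. (A * A) $$ (k, j)) + s * (\<Sum>k\<in>?F. A $$ (k, j)) + (if \<pi> j = v then p else 0)"
    using j by (simp add: sum.distrib sum_distrib_left)
  also have "\<dots> = quad_mat s p B $$ (v, \<pi> j)"
    using equitable_mult[OF E E] E v j B fibre_map_less[OF j] unfolding equitable_def quad_mat_def
    by (simp del: index_mult_mat(1))
  finally show "(\<Sum>k\<in>?F. quad_mat s p A $$ (k, j)) = quad_mat s p B $$ (v, \<pi> j)" .
qed

lemma real_symmetric_lift_mat:
  assumes "M \<in> carrier_mat n n" "real_symmetric M"
  shows "real_symmetric (lift_mat M)"
proof -
  have "M $$ (a, b) = M $$ (b, a)" if "a < n" "b < n" for a b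
    using assms that unfolding real_symmetric_def by (metis carrier_matD index_transpose_mat(1))
  then have "(lift_mat M)\<^sup>T = lift_mat M" by (intro eq_matI) (auto simp: fibre_map_less)
  then show ?thesis using assms unfolding real_symmetric_def by (auto simp: fibre_map_less)
qed

text \<open>The spectral hypothesis enters here: q vanishes on every new eigenvalue, which forces
  the trace of the squared difference of the two sides to be at most 0.\<close>

lemma quad_mat_eq_lift_mat:
  assumes E: "equitable A B" and SA: "real_symmetric A" and SB: "real_symmetric B"
    and new: "set_mset (spec_mset A - spec_mset B) = {\<theta>, \<tau>}"
  shows "quad_mat (- (\<theta> + \<tau>)) (\<theta> * \<tau>) A = lift_mat (quad_mat (- (\<theta> + \<tau>)) (\<theta> * \<tau>) B)"
proof -
  define s p where "s = - (\<theta> + \<tau>)" and "p = \<theta> * \<tau>"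
  have A: "A \<in> carrier_mat N N" and B: "B \<in> carrier_mat n n" using E unfolding equitable_def by auto
  \<comment> \<open>The new eigenvalues belong to a real symmetric matrix, so the coefficients of
    the quadratic are real and q(A), q(B) are again real symmetric.\<close>
  have "\<theta> \<in># spec_mset A" "\<tau> \<in># spec_mset A" using new by (auto intro: in_diffD)
  then have "\<theta> \<in> \<real>" "\<tau> \<in> \<real>" using real_symmetric_spec[OF A SA] by auto
  then have sp: "s \<in> \<real>" "p \<in> \<real>" unfolding s_def p_def by auto
  \<comment> \<open>This \<open>q\<close> is the square of the quadratic polynomial q of the
    overview.\<close>
  define q where "q e = (e\<^sup>2 + s * e + p)\<^sup>2" for e
  define QA QB where "QA = quad_mat s p A" and "QB = quad_mat s p B"
  have QA: "QA \<in> carrier_mat N N" and QB: "QB \<in> carrier_mat n n" unfolding QA_def QB_def using A B by auto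
  have EQ: "equitable QA QB" unfolding QA_def QB_def by (rule equitable_quad_mat[OF E])
  define L where "L = lift_mat QB"
  have L: "L \<in> carrier_mat N N" unfolding L_def by simp
  have LQ: "L * QA = lift_mat (QB * QB)" unfolding L_def by (rule lift_mat_mult[OF QB EQ])
  have "L * L = lift_mat (QB * QB)"
  proof -
    \<comment> \<open>L is constant along each fibre, so a fibre sum is r copies of an entry of
      \<open>QB\<close> divided by r. Taking L itself as the upper matrix in
      \<open>lift_mat_mult\<close> then yields L L.\<close>
    have "equitable L QB" unfolding equitable_def
    proof (intro conjI allI impI)
      fix v j assume v: "v < n" and j: "j < N"
      have "(\<Sum>k\<in>{k \<in> {..<N}. \<pi> k = v}. L $$ (k, j)) 
          = (\<Sum>k\<in>{k \<in> {..<N}. \<pi> k = v}. QB $$ (v, \<pi> j) / of_nat r)"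
        unfolding L_def using j by (intro sum.cong refl) auto
      then show "(\<Sum>k\<in>{k \<in> {..<N}. \<pi> k = v}. L $$ (k, j)) = QB $$ (v, \<pi> j)"
        using card_fibre[OF v] fibre_size_pos by simp
    qed (use L QB in auto)
    from lift_mat_mult[OF QB this] show ?thesis unfolding L_def .
  qed
  then have LL: "mat_trace (L * L) = mat_trace (QB * QB)" using mat_trace_lift_mat QB by simp
  have LQ': "mat_trace (L * QA) = mat_trace (QB * QB)" unfolding LQ using mat_trace_lift_mat QB by simp
  then have QL: "mat_trace (QA * L) = mat_trace (QB * QB)" using mat_trace_mult_commute[OF QA L] by simp
  \<comment> \<open>The three products containing L all have trace tr(QB QB); with signs -, -, +
    they leave one negative copy.\<close>
  have "(QA - L) * (QA - L) = (QA * QA - QA * L) - (L * QA - L * L)"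
    unfolding minus_mult_distrib_mat[OF QA L minus_carrier_mat[OF L]]
      mult_minus_distrib_mat[OF QA QA L] mult_minus_distrib_mat[OF L QA L] ..
  then have "mat_trace ((QA - L) * (QA - L)) = mat_trace (QA * QA) - mat_trace (QB * QB)"
    using mat_trace_minus[OF minus_carrier_mat[OF mult_carrier_mat[OF QA L]] minus_carrier_mat[OF mult_carrier_mat[OF L L]], of "QA * QA" "L * QA"]
      mat_trace_minus[OF mult_carrier_mat[OF QA QA] mult_carrier_mat[OF QA L]]
      mat_trace_minus[OF mult_carrier_mat[OF L QA] mult_carrier_mat[OF L L]] LL LQ' QL by simp
  also have "\<dots> = (\<Sum>e\<in>#spec_mset A. q e) - (\<Sum>e\<in>#spec_mset B. q e)"
    unfolding QA_def QB_def q_def mat_trace_quad_sq[OF A] mat_trace_quad_sq[OF B] ..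
  also have "\<dots> = - (\<Sum>e\<in>#spec_mset B - spec_mset A. q e)"
  proof -
    \<comment> \<open>Multiset difference is truncated; both sides take the larger of the two
      multiplicities.\<close>
    have "spec_mset A + (spec_mset B - spec_mset A) = spec_mset B + (spec_mset A - spec_mset B)"
      by (auto simp: multiset_eq_iff)
    from arg_cong[OF this, of "\<lambda>M. \<Sum>e\<in>#M. q e"]
    have "(\<Sum>e\<in>#spec_mset A. q e) + (\<Sum>e\<in>#spec_mset B - spec_mset A. q e)
        = (\<Sum>e\<in>#spec_mset B. q e) + (\<Sum>e\<in>#spec_mset A - spec_mset B. q e)"
      by simp
    moreover have "q e = 0" if "e \<in># spec_mset A - spec_mset B" for e
    proof -
      have "e = \<theta> \<or> e = \<tau>" using that new by blast
      then show ?thesis unfolding q_def s_def p_def by (auto simp: power2_eq_square algebra_simps)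
    qed
    then have "image_mset q (spec_mset A - spec_mset B) = image_mset (\<lambda>_. 0) (spec_mset A - spec_mset B)"
      by (rule image_mset_cong)
    then have "(\<Sum>e\<in>#spec_mset A - spec_mset B. q e) = 0" by simp
    ultimately show ?thesis by (simp add: algebra_simps)
  qed
  finally have tr: "mat_trace ((QA - L) * (QA - L)) = - (\<Sum>e\<in>#spec_mset B - spec_mset A. q e)" .
  have "0 \<le> Re (\<Sum>e\<in>#spec_mset B - spec_mset A. q e)"
  proof (rule Re_sum_mset_nonneg)
    fix e assume "e \<in># spec_mset B - spec_mset A"
    then have "e \<in> \<real>" using real_symmetric_spec[OF B SB] by (auto dest: in_diffD)
    then have "e\<^sup>2 + s * e + p \<in> \<real>" using sp by simp
    then obtain x where "e\<^sup>2 + s * e + p = of_real x" by (elim Reals_cases)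
    then show "0 \<le> Re (q e)" unfolding q_def by (simp flip: of_real_power)
  qed
  then have "Re (mat_trace ((QA - L) * (QA - L))) \<le> 0" unfolding tr by simp
  moreover have "real_symmetric (QA - L)"
    unfolding L_def QA_def QB_def using A B SA SB sp
    by (intro real_symmetric_minus[of _ N] real_symmetric_lift_mat real_symmetric_quad_mat[of _ N]
        real_symmetric_quad_mat[of _ n]) auto
  ultimately have 0: "QA - L = 0\<^sub>m N N"
    using QA L by (intro real_symmetric_mat_trace_sq_eq_0) auto
  have "QA = L"
  proof (rule eq_matI)
    fix i j assume "i < dim_row L" "j < dim_col L"
    then show "QA $$ (i, j) = L $$ (i, j)"
      using arg_cong[OF 0, of "\<lambda>M. M $$ (i, j)"] QA L by simp
  qed (use QA L in auto)
  then show ?thesis unfolding QA_def L_def QB_def s_def p_def .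
qed

text \<open>The same a and b serve A and B: a x + b is the remainder of x^k modulo q. Subtracting it
  leaves a multiple of q, and lifting matches such multiples: the q terms agree by hypothesis, and
  right multiplication by A becomes multiplication by B under the lift.\<close>

lemma pow_mat_mod_lift_mat:
  assumes E: "equitable A B" and Q: "quad_mat s p A = lift_mat (quad_mat s p B)"
  shows "\<exists>a b. A ^\<^sub>m k - (a \<cdot>\<^sub>m A + b \<cdot>\<^sub>m 1\<^sub>m N) = lift_mat (B ^\<^sub>m k - (a \<cdot>\<^sub>m B + b \<cdot>\<^sub>m 1\<^sub>m n))"
proof (induction k)
  case 0
  have A: "A \<in> carrier_mat N N" and B: "B \<in> carrier_mat n n" using E unfolding equitable_def by auto
  \<comment> \<open>The remainder of x^0 is 1, and both sides are zero.\<close>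
  have "A ^\<^sub>m 0 - (0 \<cdot>\<^sub>m A + 1 \<cdot>\<^sub>m 1\<^sub>m N) = lift_mat (B ^\<^sub>m 0 - (0 \<cdot>\<^sub>m B + 1 \<cdot>\<^sub>m 1\<^sub>m n))"
    using A B by (intro eq_matI) (auto simp: fibre_map_less)
  then show ?case by blast
next
  case (Suc k)
  have A: "A \<in> carrier_mat N N" and B: "B \<in> carrier_mat n n" using E unfolding equitable_def by auto
  from Suc obtain a b where
    IH: "A ^\<^sub>m k - (a \<cdot>\<^sub>m A + b \<cdot>\<^sub>m 1\<^sub>m N) = lift_mat (B ^\<^sub>m k - (a \<cdot>\<^sub>m B + b \<cdot>\<^sub>m 1\<^sub>m n))" by blast
  let ?T = "B ^\<^sub>m k - (a \<cdot>\<^sub>m B + b \<cdot>\<^sub>m 1\<^sub>m n)"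
  have T: "?T \<in> carrier_mat n n" using B by auto
  have "A ^\<^sub>m Suc k - ((b - a * s) \<cdot>\<^sub>m A + (- (a * p)) \<cdot>\<^sub>m 1\<^sub>m N)
      = lift_mat ?T * A + a \<cdot>\<^sub>m lift_mat (quad_mat s p B)"
    unfolding pow_mat_Suc_mod_quad[OF A] IH Q ..
  also have "\<dots> = lift_mat (?T * B + a \<cdot>\<^sub>m quad_mat s p B)"
    using T B by (simp add: lift_mat_mult[OF T E] lift_mat_add lift_mat_smult)
  also have "?T * B + a \<cdot>\<^sub>m quad_mat s p B
      = B ^\<^sub>m Suc k - ((b - a * s) \<cdot>\<^sub>m B + (- (a * p)) \<cdot>\<^sub>m 1\<^sub>m n)"
    unfolding pow_mat_Suc_mod_quad[OF B] ..
  finally show ?case by blast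
qed

lemma constant_diag_pow_mat:
  assumes E: "equitable A B" and SA: "real_symmetric A" and SB: "real_symmetric B"
    and new: "card (set_mset (spec_mset A - spec_mset B)) = 2"
    and diag_A: "\<And>i. i < N \<Longrightarrow> A $$ (i, i) = 0" and diag_B: "\<And>v. v < n \<Longrightarrow> B $$ (v, v) = 0"
    and const: "\<And>v. v < n \<Longrightarrow> (B ^\<^sub>m k) $$ (v, v) = c"
  shows "\<exists>d. \<forall>i<N. (A ^\<^sub>m k) $$ (i, i) = d"
proof -
  have A: "A \<in> carrier_mat N N" and B: "B \<in> carrier_mat n n" using E unfolding equitable_def by auto
  obtain \<theta> \<tau> where "set_mset (spec_mset A - spec_mset B) = {\<theta>, \<tau>}"
    using new unfolding card_2_iff by auto
  from pow_mat_mod_lift_mat[OF E quad_mat_eq_lift_mat[OF E SA SB this], of k]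
  obtain a b where
    eq: "A ^\<^sub>m k - (a \<cdot>\<^sub>m A + b \<cdot>\<^sub>m 1\<^sub>m N) = lift_mat (B ^\<^sub>m k - (a \<cdot>\<^sub>m B + b \<cdot>\<^sub>m 1\<^sub>m n))" by blast
  \<comment> \<open>The zero diagonals remove the terms with a; what remains is b from the identity
    and (c - b)/r from the lift, neither depending on i.\<close>
  have "(A ^\<^sub>m k) $$ (i, i) = b + (c - b) / of_nat r" if i: "i < N" for i
    using arg_cong[OF eq, of "\<lambda>M. M $$ (i, i)"] i A B fibre_map_less[OF i]
    by (simp add: diag_A diag_B const algebra_simps)
  then show ?thesis by blast
qed

end

section \<open>Adjacency matrices and covers of graphs\<close>

lemma pair_graph_sym: "pair_graph Z \<Longrightarrow> (x, y) \<in> parcs Z \<Longrightarrow> (y, x) \<in> parcs Z"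
proof -
  assume "pair_graph Z" and xy: "(x, y) \<in> parcs Z"
  then interpret pair_graph Z by simp
  show "(y, x) \<in> parcs Z" using arcs_symmetric[OF xy] .
qed

lemma vertex_list_props:
  assumes "finite (pverts Z)"
  shows "distinct (vertex_list Z)" "set (vertex_list Z) = pverts Z"
proof -
  have "\<exists>vs. distinct vs \<and> set vs = pverts Z" using finite_distinct_list[OF assms] by blast
  from someI_ex[OF this] show "distinct (vertex_list Z)" "set (vertex_list Z) = pverts Z"
    unfolding vertex_list_def by auto
qed

lemma adjacency_matrix_carrier:
  "adjacency_matrix Z \<in> carrier_mat (length (vertex_list Z)) (length (vertex_list Z))"
  unfolding adjacency_matrix_def Let_def by simp

lemma index_adjacency_matrix:
  "i < length (vertex_list Z) \<Longrightarrow> j < length (vertex_list Z) \<Longrightarrow>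
    adjacency_matrix Z $$ (i, j) = (if (vertex_list Z ! i, vertex_list Z ! j) \<in> parcs Z then 1 else 0)"
  unfolding adjacency_matrix_def Let_def by simp

lemma real_symmetric_adjacency_matrix:
  assumes "pair_graph Z"
  shows "real_symmetric (adjacency_matrix Z)"
proof -
  have "(adjacency_matrix Z)\<^sup>T = adjacency_matrix Z"
    using adjacency_matrix_carrier[of Z]
    by (intro eq_matI) (auto simp: index_adjacency_matrix pair_graph_sym[OF assms])
  then show ?thesis
    using adjacency_matrix_carrier[of Z] unfolding real_symmetric_def by (auto simp: index_adjacency_matrix)
qed

lemma adjacency_matrix_diag:
  assumes "pair_graph Z" "i < length (vertex_list Z)"
  shows "adjacency_matrix Z $$ (i, i) = 0"
proof -
  interpret pair_graph Z by fact
  show ?thesis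
    using assms(2) pair_no_loops[of "(vertex_list Z ! i, vertex_list Z ! i)"]
    by (auto simp: index_adjacency_matrix)
qed

text \<open>Translates the inverse of the symmetric group into the inverse function
  \<open>inv'\<close>, which is legitimate because the values on arcs are permutations of
  \<open>{1..r}\<close>.\<close>

lemma symmetric_arc_function_Some:
  assumes "pair_graph Y" "subgroup G (sym_group r)" "symmetric_arc_function Y r G f"
    and uv: "(u, v) \<in> parcs Y"
  obtains g where "g permutes {1..r}" "f u v = Some g" "f v u = Some (inv' g)"
proof -
  interpret pair_graph Y by fact
  have V: "u \<in> pverts Y" "v \<in> pverts Y" using uv by (auto dest: in_arcsD1 in_arcsD2)
  have vu: "(v, u) \<in> parcs Y" by (rule pair_graph_sym[OF assms(1) uv])
  obtain g where g: "f u v = Some g" "g \<in> G"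
    using assms(3) V uv unfolding symmetric_arc_function_def by (cases "f u v") fastforce+
  then have p: "g \<in> carrier (sym_group r)" using subgroup.subset[OF assms(2)] by auto
  have "f v u = map_option (\<lambda>g. inv\<^bsub>sym_group r\<^esub> g) (f u v)"
    using assms(3) V vu unfolding symmetric_arc_function_def by blast
  then have "f v u = Some (inv' g)" using g p by (simp add: sym_group_inv_equality)
  then show thesis using g p that by (simp add: sym_group_carrier)
qed

text \<open>The arc function is read at (u, v), opposite to the arc (v, u); on arcs of Y its value
  is never \<open>None\<close>, so \<open>the\<close> is meaningful.\<close>

lemma cover_arc_iff:
  assumes "pair_graph Y" "subgroup G (sym_group r)" "symmetric_arc_function Y r G f"
  shows "((v, j), (u, k)) \<in> parcs (cover Y r f) \<longleftrightarrow>
    j \<in> {1..r} \<and> k \<in> {1..r} \<and> (v, u) \<in> parcs Y \<and> the (f u v) j = k"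
proof -
  have "\<exists>g. f u v = Some g" if "(v, u) \<in> parcs Y"
    using symmetric_arc_function_Some[OF assms that] by metis
  then show ?thesis unfolding cover_def by fastforce
qed

text \<open>Reversing an arc inverts the permutation, which carries k back to j. Arcs of the cover
  project to arcs of Y, so a loop upstairs would give a loop in Y.\<close>

lemma pair_graph_cover:
  assumes "pair_graph Y" "subgroup G (sym_group r)" "symmetric_arc_function Y r G f"
  shows "pair_graph (cover Y r f)"
proof -
  interpret pair_graph Y by fact
  let ?X = "cover Y r f"
  have V: "pverts ?X = pverts Y \<times> {1..r}" unfolding cover_def by simp
  have arcs: "parcs ?X \<subseteq> pverts ?X \<times> pverts ?X"
    unfolding V by (auto simp: cover_arc_iff[OF assms] dest: in_arcsD1 in_arcsD2)
  have fin: "finite (pverts ?X)" unfolding V using pair_finite_verts by simp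
  have sym: "(y, x) \<in> parcs ?X" if "(x, y) \<in> parcs ?X" for x y
  proof -
    obtain v j u k where xy: "x = (v, j)" "y = (u, k)" by (cases x, cases y) auto
    have a: "j \<in> {1..r}" "k \<in> {1..r}" "(v, u) \<in> parcs Y" "the (f u v) j = k"
      using that unfolding xy cover_arc_iff[OF assms] by auto
    obtain g where g: "g permutes {1..r}" "f v u = Some g" "f u v = Some (inv' g)"
      using symmetric_arc_function_Some[OF assms a(3)] by blast
    then have "the (f v u) k = j" using a(4) permutes_inverses(1)[OF g(1)] by auto
    then show ?thesis unfolding xy cover_arc_iff[OF assms] using a pair_graph_sym[OF assms(1)] by auto
  qed
  show ?thesis
  proof unfold_locales
    fix e assume e: "e \<in> parcs ?X"
    show "fst e \<in> pverts ?X" "snd e \<in> pverts ?X" using e arcs by auto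
    show "fst e \<noteq> snd e" using e pair_no_loops[of "(fst (fst e), fst (snd e))"]
      by (cases e) (auto simp: cover_arc_iff[OF assms])
  next
    show "finite (pverts ?X)" by fact
    show "finite (parcs ?X)" using finite_subset[OF arcs] fin by auto
    show "symmetric (with_proj ?X)" using sym by (auto simp: symmetric_def intro!: symI)
  qed
qed

text \<open>The covering projection, expressed in the chosen numberings of both graphs. For a
  position k in the vertex list of a cover the description is unique, since the list of Y is
  distinct and contains every first component.\<close>

definition fibre_index :: "'a pair_pre_digraph \<Rightarrow> ('a \<times> 'b) pair_pre_digraph \<Rightarrow> nat \<Rightarrow> nat" where
  "fibre_index Y X k =
     (THE v. v < length (vertex_list Y) \<and> vertex_list Y ! v = fst (vertex_list X ! k))"

text \<open>The combinatorial input is that a vertex (u, b) of the cover has exactly one neighbour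
  over each neighbour of u and none over any other vertex; this makes the fibres equitable with
  quotient the adjacency matrix of Y.\<close>

lemma walk_regular_cover:
  assumes Y: "pair_graph Y" and G: "subgroup G (sym_group r)" and f: "symmetric_arc_function Y r G f"
    and new: "two_ev_cover Y r f" and wr: "walk_regular Y"
  shows "walk_regular (cover Y r f)"
\<comment> \<open>For r = 0 the cover has no vertices and the claim is vacuous; otherwise the
  division by r in the lift is sound.\<close>
proof (cases "r = 0")
  case True
  interpret X: pair_graph "cover Y r f" by (rule pair_graph_cover[OF Y G f])
  have "vertex_list (cover Y r f) = []"
    using vertex_list_props(2)[OF X.pair_finite_verts] True by (simp add: cover_def)
  then show ?thesis unfolding walk_regular_def adjacency_matrix_def by simp
next
  case False
  define X where "X = cover Y r f"
  have pX: "pair_graph X" unfolding X_def by (rule pair_graph_cover[OF Y G f])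
  interpret Y: pair_graph Y by fact
  interpret X: pair_graph X by fact
  define ys xs where "ys = vertex_list Y" and "xs = vertex_list X"
  define \<pi> where "\<pi> = fibre_index Y X"
  have ys: "distinct ys" "set ys = pverts Y"
    unfolding ys_def using vertex_list_props[OF Y.pair_finite_verts] by auto
  have xs: "distinct xs" "set xs = pverts Y \<times> {1..r}"
    unfolding xs_def using vertex_list_props[OF X.pair_finite_verts] by (auto simp: X_def cover_def)
  have \<pi>: "\<pi> k < length ys \<and> ys ! \<pi> k = fst (xs ! k)" if "k < length xs" for k
  proof -
    have "fst (xs ! k) \<in> set ys" using nth_mem[OF that] unfolding xs ys by auto
    then have "\<exists>!v. v < length ys \<and> ys ! v = fst (xs ! k)"
      using distinct_Ex1[OF ys(1)] by simp
    from theI'[OF this] show ?thesis unfolding \<pi>_def fibre_index_def ys_def xs_def by simp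
  qed
  have \<pi>_eq: "\<pi> k = v \<longleftrightarrow> fst (xs ! k) = ys ! v" if "k < length xs" "v < length ys" for k v
    using \<pi>[OF that(1)] that(2) ys(1) by (metis nth_eq_iff_index_eq)
  \<comment> \<open>This identifies the index fibre with the layer set over one base vertex, giving
    both the fibre size r and the reindexing of column sums below.\<close>
  have bij: "bij_betw ((!) xs) {k \<in> {..<length xs}. \<pi> k = v} ({ys ! v} \<times> {1..r})"
    if v: "v < length ys" for v
  proof (rule bij_betw_imageI)
    show "inj_on ((!) xs) {k \<in> {..<length xs}. \<pi> k = v}"
      using xs(1) by (auto simp: inj_on_def nth_eq_iff_index_eq)
    have "{ys ! v} \<times> {1..r} = {x \<in> set xs. fst x = ys ! v}"
      using nth_mem[OF v] unfolding xs ys by auto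
    also have "\<dots> = (!) xs ` {k \<in> {..<length xs}. \<pi> k = v}"
    proof (intro equalityI subsetI)
      fix x assume "x \<in> {x \<in> set xs. fst x = ys ! v}"
      then obtain k where "k < length xs" "x = xs ! k" "fst (xs ! k) = ys ! v"
        by (auto simp: in_set_conv_nth)
      then show "x \<in> (!) xs ` {k \<in> {..<length xs}. \<pi> k = v}" using \<pi>_eq[of k v] v by blast
    next
      fix x assume "x \<in> (!) xs ` {k \<in> {..<length xs}. \<pi> k = v}"
      then obtain k where "k < length xs" "x = xs ! k" "\<pi> k = v" by blast
      then show "x \<in> {x \<in> set xs. fst x = ys ! v}" using \<pi>[of k] by auto
    qed
    finally show "(!) xs ` {k \<in> {..<length xs}. \<pi> k = v} = {ys ! v} \<times> {1..r}" ..
  qed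
  interpret fibre_map "length xs" "length ys" r \<pi>
  proof
    show "\<pi> k < length ys" if "k < length xs" for k using \<pi>[OF that] by blast
    show "card {k \<in> {..<length xs}. \<pi> k = v} = r" if "v < length ys" for v
      using bij_betw_same_card[OF bij[OF that]] by (simp add: card_cartesian_product)
    show "0 < r" using False by simp
  qed
  have E: "equitable (adjacency_matrix X) (adjacency_matrix Y)"
    unfolding equitable_def
  proof (intro conjI allI impI)
    show "adjacency_matrix X \<in> carrier_mat (length xs) (length xs)"
      "adjacency_matrix Y \<in> carrier_mat (length ys) (length ys)"
      unfolding xs_def ys_def by (rule adjacency_matrix_carrier)+
    fix v j assume v: "v < length ys" and j: "j < length xs"
    obtain u b where ub: "xs ! j = (u, b)" by (cases "xs ! j")
    have b: "b \<in> {1..r}" using nth_mem[OF j] unfolding ub xs by auto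
    have u: "ys ! \<pi> j = u" "\<pi> j < length ys" using \<pi>[OF j] ub by auto
    let ?w = "ys ! v"
    have "(\<Sum>k\<in>{k \<in> {..<length xs}. \<pi> k = v}. adjacency_matrix X $$ (k, j))
        = (\<Sum>k\<in>{k \<in> {..<length xs}. \<pi> k = v}. if (xs ! k, (u, b)) \<in> parcs X then 1 else 0)"
      using j ub unfolding xs_def by (intro sum.cong refl) (simp add: index_adjacency_matrix)
    also have "\<dots> = (\<Sum>x\<in>{?w} \<times> {1..r}. if (x, (u, b)) \<in> parcs X then 1 else 0)"
      by (rule sum.reindex_bij_betw[OF bij[OF v]])
    also have "\<dots> = (\<Sum>a\<in>{1..r}. if ((?w, a), (u, b)) \<in> parcs X then 1 else 0)"
      by (rule sum.reindex_bij_witness[of _ "\<lambda>a. (?w, a)" snd]) auto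
    also have "\<dots> = (if (?w, u) \<in> parcs Y then 1 else 0)"
    proof (cases "(?w, u) \<in> parcs Y")
      case True
      obtain g where g: "g permutes {1..r}" "f u ?w = Some g"
        using symmetric_arc_function_Some[OF Y G f pair_graph_sym[OF Y True]] by blast
      \<comment> \<open>The value g is a bijection of \<open>{1..r}\<close>, so g a = b has a single
        solution: one layer over \<open>?w\<close> is joined to (u, b).\<close>
      have "(((?w, a), (u, b)) \<in> parcs X) = (a = inv' g b)" if "a \<in> {1..r}" for a
        unfolding X_def cover_arc_iff[OF Y G f] using True g that b permutes_inv_eq[OF g(1)] by auto
      then have "(\<Sum>a\<in>{1..r}. if ((?w, a), (u, b)) \<in> parcs X then 1 else (0 :: complex))
          = (\<Sum>a\<in>{1..r}. if a = inv' g b then 1 else 0)"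
        by (intro sum.cong refl) simp
      moreover have "inv' g b \<in> {1..r}" using permutes_in_image[OF permutes_inv[OF g(1)]] b by blast
      ultimately show ?thesis using True by (simp del: atLeastAtMost_iff)
    next
      case False
      then show ?thesis unfolding X_def cover_arc_iff[OF Y G f] by simp
    qed
    also have "\<dots> = adjacency_matrix Y $$ (v, \<pi> j)"
      using v u by (simp add: ys_def index_adjacency_matrix)
    finally show "(\<Sum>k\<in>{k \<in> {..<length xs}. \<pi> k = v}. adjacency_matrix X $$ (k, j))
        = adjacency_matrix Y $$ (v, \<pi> j)" .
  qed
  show ?thesis
    unfolding walk_regular_def Let_def X_def[symmetric]
  proof (intro allI impI)
    fix k :: nat assume "k > 0"
    then obtain c where c: "\<forall>i<dim_row (adjacency_matrix Y). (adjacency_matrix Y ^\<^sub>m k) $$ (i, i) = c"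
      using wr unfolding walk_regular_def Let_def by blast
    have "\<exists>d. \<forall>i<length xs. (adjacency_matrix X ^\<^sub>m k) $$ (i, i) = d"
    proof (rule constant_diag_pow_mat[OF E])
      show "card (set_mset (spec_mset (adjacency_matrix X) - spec_mset (adjacency_matrix Y))) = 2"
        using new unfolding two_ev_cover_def X_def .
      show "(adjacency_matrix Y ^\<^sub>m k) $$ (v, v) = c" if "v < length ys" for v
        using c that adjacency_matrix_carrier[of Y] unfolding ys_def by auto
    qed (auto simp: xs_def ys_def adjacency_matrix_diag real_symmetric_adjacency_matrix pX Y)
    then show "\<exists>c. \<forall>i<dim_row (adjacency_matrix X). (adjacency_matrix X ^\<^sub>m k) $$ (i, i) = c"
      using adjacency_matrix_carrier[of X] unfolding xs_def by auto
  qed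
qed

theorem theorem5p1:
  fixes Y :: "'a pair_pre_digraph"
    and r :: nat
    and G :: "(nat \<Rightarrow> nat) set"
    and f :: "'a \<Rightarrow> 'a \<Rightarrow> (nat \<Rightarrow> nat) option"
    and X :: "('a \<times> nat) pair_pre_digraph"
  assumes "pair_graph Y"
    and "Digraph_Component.connected (with_proj Y)"
    and "subgroup G (sym_group r)"
    and "symmetric_arc_function Y r G f"
    and "normalized Y f"
    and "acts_regularly (carrier (arc_function_group Y r f)) {1..r}"
    and "X = cover Y r f"
    and "cyclic_group (arc_function_group Y r f)"
    and "two_ev_cover Y r f"
    and "walk_regular Y"
  shows "walk_regular X"
  using walk_regular_cover[OF assms(1,3,4,9,10)] assms(7) by simp

end
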